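(* Let $L$ be a complete lattice and let $(\mathcal{Q},E)$ be an $L$-groupoid with $\mathcal{Q}=(Q,\cdot)$. If the equations $a\cdot x=b$ and $y\cdot a=b$ are $E$-uniquely solvable over $(\mathcal{Q},E)$ for all $a,b\in Q$, then for every $p\in L$ the quotient groupoid $\mu_p/E_p$ is a quasigroup.
   Context: $(L,\wedge,\vee,\leqslant)$ is a complete lattice with top $1$ and bottom $0$. A groupoid is a nonempty set with one binary operation. An $L$-groupoid is a pair $(\mathcal{Q},E)$ where $\mathcal{Q}=(Q,\cdot)$ is a groupoid and $E:Q^2\to L$ is a compatible $L$-valued equality, i.e. for all elements of $Q$: $E(x,y)=E(y,x)$ (symmetry); $E(x,z)\wedge E(z,y)\leqslant E(x,y)$ (transitivity); $E(x,y)=1$ implies $x=y$; and $E(x,y)\wedge E(u,v)\leqslant E(x\cdot u,y\cdot v)$ (compatibility). Reflexivity $E(x,x)=1$ is not assumed. Put $\mu(x)=E(x,x)$. For $p\in L$ let $\mu_p=\{x\in Q\mid \mu(x)\geqslant p\}$ and $E_p=\{(x,y)\in Q^2\mid E(x,y)\geqslant p\}$. Then $\mu_p$ is closed under $\cdot$ and $E_p$ is a congruence on $\mu_p$; $\mu_p/E_p$ is the quotient with $[a]_{E_p}\cdot[b]_{E_p}=[a\cdot b]_{E_p}$. Statements about $\mu_p/E_p$ are understood to hold vacuously when $\mu_p=\emptyset$. A groupoid is a quasigroup if for all its elements $A,B$ each of the equations $A\cdot X=B$ and $Y\cdot A=B$ has exactly one solution. For $a,b\in Q$: an element $c\in Q$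 is a solution of $a\cdot x=b$ in $(\mathcal{Q},E)$ if $\mu(a)\wedge\mu(b)\leqslant\mu(c)\wedge E(a\cdot c,b)$; an element $d\in Q$ is a solution of $y\cdot a=b$ in $(\mathcal{Q},E)$ if $\mu(a)\wedge\mu(b)\leqslant\mu(d)\wedge E(d\cdot a,b)$. The equation is solvable over $(\mathcal{Q},E)$ if it has a solution. The equation $a\cdot x=b$ is $E$-uniquely solvable over $(\mathcal{Q},E)$ if it is solvable and, for every solution $c$, every $p\leqslant\mu(a)\wedge\mu(b)$ and every $c_1\in Q$ with $E(a\cdot c_1,b)\geqslant p$, one has $E(c,c_1)\geqslant p$. Analogously, $y\cdot a=b$ is $E$-uniquely solvable if it is solvable and, for every solution $d$, every $p\leqslant\mu(a)\wedge\mu(b)$ and every $d_1\in Q$ with $E(d_1\cdot a,b)\geqslant p$, one has $E(d,d_1)\geqslant p$. *)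

theory Defs
  imports Main
begin

locale groupoid =
  fixes Q :: "'a set" and mult :: "'a \<Rightarrow> 'a \<Rightarrow> 'a"  (infixl "\<cdot>" 70)
  assumes nonempty: "Q \<noteq> {}"
    and closed: "\<lbrakk>x \<in> Q; y \<in> Q\<rbrakk> \<Longrightarrow> x \<cdot> y \<in> Q"

locale quasigroup = groupoid +
  assumes left_division: "\<lbrakk>a \<in> Q; b \<in> Q\<rbrakk> \<Longrightarrow> \<exists>!x. x \<in> Q \<and> a \<cdot> x = b"
    and right_division: "\<lbrakk>a \<in> Q; b \<in> Q\<rbrakk> \<Longrightarrow> \<exists>!y. y \<in> Q \<and> y \<cdot> a = b"

text \<open>
  Reflexivity of \<open>E\<close> is deliberately not assumed. The values of \<open>E\<close> outside
  \<open>Q\<close> are arbitrary and are never used.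
\<close>

locale L_groupoid = groupoid +
  fixes E :: "'a \<Rightarrow> 'a \<Rightarrow> 'l :: complete_lattice"
  assumes symmetric: "\<lbrakk>x \<in> Q; y \<in> Q\<rbrakk> \<Longrightarrow> E x y = E y x"
    and transitive: "\<lbrakk>x \<in> Q; y \<in> Q; z \<in> Q\<rbrakk> \<Longrightarrow> inf (E x z) (E z y) \<le> E x y"
    and separated: "\<lbrakk>x \<in> Q; y \<in> Q; E x y = top\<rbrakk> \<Longrightarrow> x = y"
    and compatible: "\<lbrakk>x \<in> Q; y \<in> Q; u \<in> Q; v \<in> Q\<rbrakk>
      \<Longrightarrow> inf (E x y) (E u v) \<le> E (x \<cdot> u) (y \<cdot> v)"

definition mu :: "('a \<Rightarrow> 'a \<Rightarrow> 'l) \<Rightarrow> 'a \<Rightarrow> 'l" where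
  "mu E x = E x x"

definition mu_cut :: "'a set \<Rightarrow> ('a \<Rightarrow> 'a \<Rightarrow> 'l :: complete_lattice) \<Rightarrow> 'l \<Rightarrow> 'a set" where
  "mu_cut Q E p = {x \<in> Q. p \<le> mu E x}"

definition E_cut :: "'a set \<Rightarrow> ('a \<Rightarrow> 'a \<Rightarrow> 'l :: complete_lattice) \<Rightarrow> 'l \<Rightarrow> ('a \<times> 'a) set" where
  "E_cut Q E p = {(x, y). x \<in> Q \<and> y \<in> Q \<and> p \<le> E x y}"

text \<open>
  The product of two classes is the union of the classes of all products of
  representatives. By compatibility these classes coincide, so that
  \<open>[a] \<cdot> [b] = [a \<cdot> b]\<close>; see \<open>cut_mult_class\<close> below.
\<close>

definition cut_mult ::
  "'a set \<Rightarrow> ('a \<Rightarrow> 'a \<Rightarrow> 'a) \<Rightarrow> ('a \<Rightarrow> 'a \<Rightarrow> 'l :: complete_lattice) \<Rightarrow> 'l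
    \<Rightarrow> 'a set \<Rightarrow> 'a set \<Rightarrow> 'a set" where
  "cut_mult Q m E p A B = (\<Union>a\<in>A. \<Union>b\<in>B. E_cut Q E p `` {m a b})"

definition solves_right ::
  "'a set \<Rightarrow> ('a \<Rightarrow> 'a \<Rightarrow> 'a) \<Rightarrow> ('a \<Rightarrow> 'a \<Rightarrow> 'l :: complete_lattice) \<Rightarrow> 'a \<Rightarrow> 'a \<Rightarrow> 'a \<Rightarrow> bool" where
  "solves_right Q m E a b c \<longleftrightarrow>
     c \<in> Q \<and> inf (mu E a) (mu E b) \<le> inf (mu E c) (E (m a c) b)"

definition solves_left ::
  "'a set \<Rightarrow> ('a \<Rightarrow> 'a \<Rightarrow> 'a) \<Rightarrow> ('a \<Rightarrow> 'a \<Rightarrow> 'l :: complete_lattice) \<Rightarrow> 'a \<Rightarrow> 'a \<Rightarrow> 'a \<Rightarrow> bool" where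
  "solves_left Q m E a b d \<longleftrightarrow>
     d \<in> Q \<and> inf (mu E a) (mu E b) \<le> inf (mu E d) (E (m d a) b)"

definition E_uniquely_solvable_right ::
  "'a set \<Rightarrow> ('a \<Rightarrow> 'a \<Rightarrow> 'a) \<Rightarrow> ('a \<Rightarrow> 'a \<Rightarrow> 'l :: complete_lattice) \<Rightarrow> 'a \<Rightarrow> 'a \<Rightarrow> bool" where
  "E_uniquely_solvable_right Q m E a b \<longleftrightarrow>
     (\<exists>c. solves_right Q m E a b c) \<and>
     (\<forall>c p. \<forall>c1\<in>Q. solves_right Q m E a b c \<longrightarrow> p \<le> inf (mu E a) (mu E b) \<longrightarrow>
        p \<le> E (m a c1) b \<longrightarrow> p \<le> E c c1)"

definition E_uniquely_solvable_left ::
  "'a set \<Rightarrow> ('a \<Rightarrow> 'a \<Rightarrow> 'a) \<Rightarrow> ('a \<Rightarrow> 'a \<Rightarrow> 'l :: complete_lattice) \<Rightarrow> 'a \<Rightarrow> 'a \<Rightarrow> bool" where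
  "E_uniquely_solvable_left Q m E a b \<longleftrightarrow>
     (\<exists>d. solves_left Q m E a b d) \<and>
     (\<forall>d p. \<forall>d1\<in>Q. solves_left Q m E a b d \<longrightarrow> p \<le> inf (mu E a) (mu E b) \<longrightarrow>
        p \<le> E (m d1 a) b \<longrightarrow> p \<le> E d d1)"

context L_groupoid
begin

lemma E_cut_in_mu_cut:
  assumes "(x, y) \<in> E_cut Q E p"
  shows "x \<in> mu_cut Q E p"
proof -
  have Q: "x \<in> Q" "y \<in> Q" and p: "p \<le> E x y"
    using assms by (auto simp: E_cut_def)
  have "inf (E x y) (E y x) \<le> E x x"
    using Q by (intro transitive)
  with p have "p \<le> E x x"
    using symmetric[OF Q] by simp
  with Q show ?thesis
    by (simp add: mu_cut_def mu_def)
qed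

lemma E_cut_sym: "(x, y) \<in> E_cut Q E p \<Longrightarrow> (y, x) \<in> E_cut Q E p"
  using symmetric by (auto simp: E_cut_def)

lemma E_cut_trans:
  assumes "(x, y) \<in> E_cut Q E p" "(y, z) \<in> E_cut Q E p"
  shows "(x, z) \<in> E_cut Q E p"
  using assms transitive[of x z y] by (auto simp: E_cut_def intro: order_trans[OF le_infI])

lemma E_cut_mult:
  assumes "(x, y) \<in> E_cut Q E p" "(u, v) \<in> E_cut Q E p"
  shows "(x \<cdot> u, y \<cdot> v) \<in> E_cut Q E p"
  using assms compatible[of x y u v] closed by (auto simp: E_cut_def intro: order_trans[OF le_infI])

lemma equiv_E_cut: "equiv (mu_cut Q E p) (E_cut Q E p)"
proof (rule equivI)
  show "E_cut Q E p \<subseteq> mu_cut Q E p \<times> mu_cut Q E p"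
    using E_cut_in_mu_cut E_cut_sym by fast
  show "refl_on (mu_cut Q E p) (E_cut Q E p)"
    by (auto simp: refl_on_def E_cut_def mu_cut_def mu_def)
  show "sym (E_cut Q E p)"
    using E_cut_sym by (auto intro: symI)
  show "trans (E_cut Q E p)"
    using E_cut_trans by (auto intro: transI)
qed

lemma mu_cut_closed:
  "\<lbrakk>x \<in> mu_cut Q E p; y \<in> mu_cut Q E p\<rbrakk> \<Longrightarrow> x \<cdot> y \<in> mu_cut Q E p"
  using E_cut_mult[of x x p y y] closed
  by (auto simp: E_cut_def mu_cut_def mu_def)

lemma cut_mult_class:
  assumes "a \<in> mu_cut Q E p" "b \<in> mu_cut Q E p"
  shows "cut_mult Q (\<cdot>) E p (E_cut Q E p `` {a}) (E_cut Q E p `` {b}) = E_cut Q E p `` {a \<cdot> b}"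
proof -
  have "a \<in> E_cut Q E p `` {a}" "b \<in> E_cut Q E p `` {b}"
    using assms by (auto simp: E_cut_def mu_cut_def mu_def)
  moreover have "E_cut Q E p `` {x \<cdot> y} = E_cut Q E p `` {a \<cdot> b}"
    if "x \<in> E_cut Q E p `` {a}" "y \<in> E_cut Q E p `` {b}" for x y
    using that E_cut_mult E_cut_sym E_cut_trans by blast
  ultimately show ?thesis
    unfolding cut_mult_def by blast
qed

end

end

theory Submission
  imports Defs
begin

text \<open>
  An equation \<open>[a] \<cdot> X = [b]\<close> between classes at level \<open>p\<close> says, for a representative \<open>x\<close> of
  \<open>X\<close>, that \<open>p \<le> E (a \<cdot> x) b\<close>. Since \<open>a\<close> and \<open>b\<close> lie in the cut of \<open>\<mu>\<close> at \<open>p\<close>, we have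
  \<open>p \<le> \<mu> a \<sqinter> \<mu> b\<close>; hence every solution \<open>c\<close> of \<open>a \<cdot> x = b\<close> over the \<open>L\<close>-groupoid satisfies
  both \<open>p \<le> \<mu> c\<close>, so that its class is an element of the quotient, and \<open>p \<le> E (a \<cdot> c) b\<close>, so
  that this class solves the equation. The uniqueness clause, read at the level \<open>p\<close>, says that
  any such \<open>x\<close> has \<open>p \<le> E c x\<close>, that is, \<open>X = [c]\<close>. This is
  \<open>ex1_class_right_solution\<close>. The equations \<open>Y \<cdot> [a] = [b]\<close> are the same equations
  in the opposite \<open>L\<close>-groupoid, whose cuts carry the opposite multiplication.
\<close>

context L_groupoid
begin

lemma E_cut_class_eq_iff:
  assumes "x \<in> mu_cut Q E p" "y \<in> mu_cut Q E p"
  shows "E_cut Q E p `` {x} = E_cut Q E p `` {y} \<longleftrightarrow> p \<le> E x y"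
  using eq_equiv_class_iff[OF equiv_E_cut assms] assms by (simp add: E_cut_def mu_cut_def)

lemma groupoid_quotient:
  assumes "mu_cut Q E p \<noteq> {}"
  shows "groupoid (mu_cut Q E p // E_cut Q E p) (cut_mult Q (\<cdot>) E p)"
proof
  show "mu_cut Q E p // E_cut Q E p \<noteq> {}"
    using assms by (simp add: quotient_def)
  show "cut_mult Q (\<cdot>) E p A B \<in> mu_cut Q E p // E_cut Q E p"
    if "A \<in> mu_cut Q E p // E_cut Q E p" "B \<in> mu_cut Q E p // E_cut Q E p" for A B
    using that by (auto elim!: quotientE simp: cut_mult_class intro!: quotientI mu_cut_closed)
qed

text \<open>
  The level \<open>p\<close> is used twice as a lower bound of \<open>\<mu> a \<sqinter> \<mu> b\<close>: to see that a solution
  over the \<open>L\<close>-groupoid lies in the cut, and to apply the uniqueness clause to any other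
  representative that solves the equation at level \<open>p\<close>.
\<close>

lemma ex1_class_right_solution:
  assumes a: "a \<in> mu_cut Q E p" and b: "b \<in> mu_cut Q E p"
    and solvable: "E_uniquely_solvable_right Q (\<cdot>) E a b"
  shows "\<exists>!X. X \<in> mu_cut Q E p // E_cut Q E p \<and>
    cut_mult Q (\<cdot>) E p (E_cut Q E p `` {a}) X = E_cut Q E p `` {b}"
proof -
  have p: "p \<le> inf (mu E a) (mu E b)"
    using a b by (simp add: mu_cut_def)
  have equation: "cut_mult Q (\<cdot>) E p (E_cut Q E p `` {a}) (E_cut Q E p `` {x}) = E_cut Q E p `` {b}
      \<longleftrightarrow> p \<le> E (a \<cdot> x) b" if "x \<in> mu_cut Q E p" for x
    using that a b by (simp add: cut_mult_class E_cut_class_eq_iff mu_cut_closed)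
  obtain c where c: "solves_right Q (\<cdot>) E a b c"
    using solvable unfolding E_uniquely_solvable_right_def by blast
  then have "c \<in> Q" and "p \<le> inf (mu E c) (E (a \<cdot> c) b)"
    using order_trans[OF p] unfolding solves_right_def by blast+
  then have c_cut: "c \<in> mu_cut Q E p" and c_eq: "p \<le> E (a \<cdot> c) b"
    by (simp_all add: mu_cut_def)
  show ?thesis
  proof (rule ex1I[of _ "E_cut Q E p `` {c}"])
    show "E_cut Q E p `` {c} \<in> mu_cut Q E p // E_cut Q E p \<and>
        cut_mult Q (\<cdot>) E p (E_cut Q E p `` {a}) (E_cut Q E p `` {c}) = E_cut Q E p `` {b}"
      using c_cut c_eq equation by (simp add: quotientI)
  next
    fix X
    assume X: "X \<in> mu_cut Q E p // E_cut Q E p \<and>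
        cut_mult Q (\<cdot>) E p (E_cut Q E p `` {a}) X = E_cut Q E p `` {b}"
    then obtain x where x: "x \<in> mu_cut Q E p" and X_eq: "X = E_cut Q E p `` {x}"
      by (auto elim: quotientE)
    have "p \<le> E (a \<cdot> x) b"
      using X X_eq equation[OF x] by simp
    moreover have "x \<in> Q"
      using x by (simp add: mu_cut_def)
    ultimately have "p \<le> E c x"
      using solvable c p unfolding E_uniquely_solvable_right_def by blast
    then show "X = E_cut Q E p `` {c}"
      using E_cut_class_eq_iff[OF c_cut x] X_eq by simp
  qed
qed

text \<open>
  Reversing the multiplication exchanges the two kinds of equations, so that one existence
  and uniqueness argument serves for both divisions.
\<close>

lemma L_groupoid_opposite: "L_groupoid Q (\<lambda>x y. y \<cdot> x) E"
proof
  show "inf (E x y) (E u v) \<le> E (u \<cdot> x) (v \<cdot> y)"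
    if "x \<in> Q" "y \<in> Q" "u \<in> Q" "v \<in> Q" for x y u v
    using compatible[of u v x y] that by (simp add: inf.commute)
qed (fact nonempty, auto intro: closed symmetric transitive separated)

end

lemma E_uniquely_solvable_left_iff_opposite:
  "E_uniquely_solvable_left Q m E a b \<longleftrightarrow> E_uniquely_solvable_right Q (\<lambda>x y. m y x) E a b"
  by (simp add: E_uniquely_solvable_left_def E_uniquely_solvable_right_def
      solves_left_def solves_right_def)

lemma cut_mult_opposite: "cut_mult Q (\<lambda>x y. m y x) E p A B = cut_mult Q m E p B A"
  unfolding cut_mult_def by blast

theorem theorem3:
  fixes Q :: "'a set" and m :: "'a \<Rightarrow> 'a \<Rightarrow> 'a" and E :: "'a \<Rightarrow> 'a \<Rightarrow> 'l :: complete_lattice"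
  assumes "L_groupoid Q m E"
    and "\<And>a b. \<lbrakk>a \<in> Q; b \<in> Q\<rbrakk> \<Longrightarrow> E_uniquely_solvable_right Q m E a b"
    and "\<And>a b. \<lbrakk>a \<in> Q; b \<in> Q\<rbrakk> \<Longrightarrow> E_uniquely_solvable_left Q m E a b"
  shows "\<forall>p :: 'l. mu_cut Q E p \<noteq> {} \<longrightarrow>
    quasigroup (mu_cut Q E p // E_cut Q E p) (cut_mult Q m E p)"
proof (intro allI impI)
  fix p :: 'l
  assume cut_nonempty: "mu_cut Q E p \<noteq> {}"
  interpret L_groupoid Q m E by fact
  interpret opposite: L_groupoid Q "\<lambda>x y. m y x" E by (fact L_groupoid_opposite)
  let ?K = "mu_cut Q E p // E_cut Q E p"
  interpret quotient: groupoid ?K "cut_mult Q m E p"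
    using cut_nonempty by (rule groupoid_quotient)
  show "quasigroup ?K (cut_mult Q m E p)"
  proof
    fix A B
    assume "A \<in> ?K" "B \<in> ?K"
    then obtain a b where a: "a \<in> mu_cut Q E p" "A = E_cut Q E p `` {a}"
      and b: "b \<in> mu_cut Q E p" "B = E_cut Q E p `` {b}"
      by (auto elim!: quotientE)
    then have "a \<in> Q" "b \<in> Q"
      by (simp_all add: mu_cut_def)
    then show "\<exists>!X. X \<in> ?K \<and> cut_mult Q m E p A X = B"
      using ex1_class_right_solution[OF a(1) b(1)] assms(2) a(2) b(2) by simp
    show "\<exists>!Y. Y \<in> ?K \<and> cut_mult Q m E p Y A = B"
      using opposite.ex1_class_right_solution[OF a(1) b(1)] assms(3) \<open>a \<in> Q\<close> \<open>b \<in> Q\<close> a(2) b(2)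
      by (simp add: E_uniquely_solvable_left_iff_opposite cut_mult_opposite[of Q m])
  qed
qed

end
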